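(* Let $(\Omega_n,P_n,\pi_n)_{n}$ be a sequence of finite irreducible lazy reversible Markov chains such that $t_{\mathrm{mix}}^{(n)}\to\infty$ as $n\to\infty$. Then $$\sup_{\varepsilon\in(0,1/2]}\limsup_{n\to\infty}\frac{t_{\mathrm{mix}}^{(n)}(\varepsilon)}{t_{\mathrm{mix}}^{(n)}(1-\varepsilon)}\;\le\; 2\sup_{\varepsilon\in(0,1/2]}\limsup_{n\to\infty}\frac{t_{\mathrm{sep}}^{(n)}(\varepsilon)}{t_{\mathrm{sep}}^{(n)}(1-\varepsilon)}.$$
   Context: All chains are discrete-time. Reversible: $\pi(x)P(x,y)=\pi(y)P(y,x)$ for all $x,y$. Lazy: $P(x,x)\ge1/2$ for all $x$. $\|\mu-\nu\|_{\mathrm{TV}}=\frac12\sum_x|\mu(x)-\nu(x)|$, $d(t)=\max_{x}\|P^t(x,\cdot)-\pi\|_{\mathrm{TV}}$, $t_{\mathrm{mix}}(\varepsilon)=\inf\{t: d(t)\le\varepsilon\}$, $t_{\mathrm{mix}}=t_{\mathrm{mix}}(1/4)$, $d_{\mathrm{sep}}(t)=1-\min_{x,y\in\Omega}P^t(x,y)/\pi(y)$, $t_{\mathrm{sep}}(\varepsilon)=\inf\{t:d_{\mathrm{sep}}(t)\le\varepsilon\}$. A superscript $(n)$ denotes the quantity for the $n$-th chain of the sequence. *)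

theory Defs
  imports Complex_Main "HOL-Library.Extended_Real"
begin

text \<open>
  A finite Markov chain is given by a finite set \<open>\<Omega>\<close> inside an arbitrary type, a transition
  matrix \<open>P\<close> and a distribution \<open>\<pi>\<close>; the values of \<open>P\<close> and \<open>\<pi>\<close> outside \<open>\<Omega>\<close> are never used.
  Explicit carrier sets let the state space vary along a sequence of chains.
\<close>

definition distribution_on :: "'a set \<Rightarrow> ('a \<Rightarrow> real) \<Rightarrow> bool" where
  "distribution_on \<Omega> \<mu> \<longleftrightarrow> (\<forall>x\<in>\<Omega>. 0 \<le> \<mu> x) \<and> (\<Sum>x\<in>\<Omega>. \<mu> x) = 1"

definition finite_markov_chain :: "'a set \<Rightarrow> ('a \<Rightarrow> 'a \<Rightarrow> real) \<Rightarrow> ('a \<Rightarrow> real) \<Rightarrow> bool" where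
  "finite_markov_chain \<Omega> P \<pi> \<longleftrightarrow>
     finite \<Omega> \<and> \<Omega> \<noteq> {} \<and>
     (\<forall>x\<in>\<Omega>. distribution_on \<Omega> (P x)) \<and>
     distribution_on \<Omega> \<pi> \<and>
     (\<forall>y\<in>\<Omega>. (\<Sum>x\<in>\<Omega>. \<pi> x * P x y) = \<pi> y)"

primrec step_prob :: "'a set \<Rightarrow> ('a \<Rightarrow> 'a \<Rightarrow> real) \<Rightarrow> nat \<Rightarrow> 'a \<Rightarrow> 'a \<Rightarrow> real" where
  "step_prob \<Omega> P 0 x y = (if x = y then 1 else 0)"
| "step_prob \<Omega> P (Suc t) x y = (\<Sum>z\<in>\<Omega>. P x z * step_prob \<Omega> P t z y)"

definition irreducible_chain :: "'a set \<Rightarrow> ('a \<Rightarrow> 'a \<Rightarrow> real) \<Rightarrow> bool" where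
  "irreducible_chain \<Omega> P \<longleftrightarrow> (\<forall>x\<in>\<Omega>. \<forall>y\<in>\<Omega>. \<exists>t. step_prob \<Omega> P t x y > 0)"

definition reversible_chain :: "'a set \<Rightarrow> ('a \<Rightarrow> 'a \<Rightarrow> real) \<Rightarrow> ('a \<Rightarrow> real) \<Rightarrow> bool" where
  "reversible_chain \<Omega> P \<pi> \<longleftrightarrow> (\<forall>x\<in>\<Omega>. \<forall>y\<in>\<Omega>. \<pi> x * P x y = \<pi> y * P y x)"

definition lazy_chain :: "'a set \<Rightarrow> ('a \<Rightarrow> 'a \<Rightarrow> real) \<Rightarrow> bool" where
  "lazy_chain \<Omega> P \<longleftrightarrow> (\<forall>x\<in>\<Omega>. P x x \<ge> 1 / 2)"

definition tv_dist :: "'a set \<Rightarrow> ('a \<Rightarrow> real) \<Rightarrow> ('a \<Rightarrow> real) \<Rightarrow> real" where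
  "tv_dist \<Omega> \<mu> \<nu> = 1 / 2 * (\<Sum>x\<in>\<Omega>. \<bar>\<mu> x - \<nu> x\<bar>)"

definition d_tv :: "'a set \<Rightarrow> ('a \<Rightarrow> 'a \<Rightarrow> real) \<Rightarrow> ('a \<Rightarrow> real) \<Rightarrow> nat \<Rightarrow> real" where
  "d_tv \<Omega> P \<pi> t = (MAX x\<in>\<Omega>. tv_dist \<Omega> (step_prob \<Omega> P t x) \<pi>)"

definition d_sep :: "'a set \<Rightarrow> ('a \<Rightarrow> 'a \<Rightarrow> real) \<Rightarrow> ('a \<Rightarrow> real) \<Rightarrow> nat \<Rightarrow> real" where
  "d_sep \<Omega> P \<pi> t = 1 - (MIN (x, y)\<in>\<Omega> \<times> \<Omega>. step_prob \<Omega> P t x y / \<pi> y)"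

text \<open>
  For a finite irreducible lazy chain and \<open>\<epsilon> > 0\<close> the sets below are nonempty by the
  convergence theorem, so the infimum over the natural numbers is an attained minimum
  (the value \<open>Inf {} = 0\<close> does not occur).
\<close>

definition t_mix :: "'a set \<Rightarrow> ('a \<Rightarrow> 'a \<Rightarrow> real) \<Rightarrow> ('a \<Rightarrow> real) \<Rightarrow> real \<Rightarrow> nat" where
  "t_mix \<Omega> P \<pi> \<epsilon> = Inf {t. d_tv \<Omega> P \<pi> t \<le> \<epsilon>}"

definition t_sep :: "'a set \<Rightarrow> ('a \<Rightarrow> 'a \<Rightarrow> real) \<Rightarrow> ('a \<Rightarrow> real) \<Rightarrow> real \<Rightarrow> nat" where
  "t_sep \<Omega> P \<pi> \<epsilon> = Inf {t. d_sep \<Omega> P \<pi> t \<le> \<epsilon>}"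

text \<open>
  The ratios are formed in the extended reals because a denominator can vanish
  (\<open>t_mix (1 - \<epsilon>) = 0\<close> whenever every state has stationary mass at least \<open>\<epsilon>\<close>):
  there \<open>a / 0 = \<infinity>\<close> for \<open>a > 0\<close>, whereas division of reals would give \<open>0\<close>.
  The convention \<open>0 / 0 = 0\<close> is harmless: when \<open>t_mix (1 / 4) \<rightarrow> \<infinity>\<close>, no \<open>0 / 0\<close> occurs for
  \<open>\<epsilon> \<le> 1 / 4\<close> and large indices, and suprema over \<open>\<epsilon>\<close> of the ratios are governed by small \<open>\<epsilon>\<close>.
\<close>

definition mix_ratio :: "'a set \<Rightarrow> ('a \<Rightarrow> 'a \<Rightarrow> real) \<Rightarrow> ('a \<Rightarrow> real) \<Rightarrow> real \<Rightarrow> ereal" where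
  "mix_ratio \<Omega> P \<pi> \<epsilon> = ereal (real (t_mix \<Omega> P \<pi> \<epsilon>)) / ereal (real (t_mix \<Omega> P \<pi> (1 - \<epsilon>)))"

definition sep_ratio :: "'a set \<Rightarrow> ('a \<Rightarrow> 'a \<Rightarrow> real) \<Rightarrow> ('a \<Rightarrow> real) \<Rightarrow> real \<Rightarrow> ereal" where
  "sep_ratio \<Omega> P \<pi> \<epsilon> = ereal (real (t_sep \<Omega> P \<pi> \<epsilon>)) / ereal (real (t_sep \<Omega> P \<pi> (1 - \<epsilon>)))"

end

theory Submission
  imports Defs "HOL-Analysis.Convex"
begin

text \<open>
  At \<open>t = t_mix (1 - \<epsilon>)\<close> the functions \<open>f\<^sub>x = min (P\<^sup>t(x, -) / \<pi>) 1\<close> all have mean at least \<open>\<epsilon>\<close>,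
  and reversibility gives \<open>P\<^bsup>2t+s\<^esup>(x, y) / \<pi>(y) \<ge> \<langle>f\<^sub>x, P\<^sup>s f\<^sub>y\<rangle> \<ge> \<epsilon>\<^sup>2 - \<epsilon>\<^sup>2 / 2\<close> as soon as \<open>P\<^sup>s\<close> has norm at
  most \<open>\<epsilon>\<^sup>2 / 2\<close> on centred functions; hence \<open>t_sep (1 - \<epsilon>\<^sup>2 / 2) \<le> 2 t_mix (1 - \<epsilon>) + s\<close>.
  If the right-hand side of the theorem is finite, then \<open>t_mix \<delta> \<le> t_sep \<delta> \<le> C t_mix (1 / 4)\<close> for
  every \<open>\<delta> > 0\<close> with \<open>C\<close> independent of \<open>\<delta>\<close>. Since the norm of \<open>P\<^sup>T\<close> on centred functions is at
  most \<open>2 d(T)\<close> and that of \<open>P\<^sup>s\<close> at most the \<open>k\<close>-th root of that of \<open>P\<^bsup>ks\<^esup>\<close>, a small \<open>\<delta>\<close> shows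
  that \<open>s\<close> may be taken as \<open>o(t_mix (1 / 4))\<close>. Finally \<open>t_mix \<le> t_sep\<close>.
\<close>

locale reversible_markov_chain =
  fixes \<Omega> :: "'a set" and P :: "'a \<Rightarrow> 'a \<Rightarrow> real" and \<pi> :: "'a \<Rightarrow> real"
  assumes chain: "finite_markov_chain \<Omega> P \<pi>"
    and irreducible: "irreducible_chain \<Omega> P"
    and lazy: "lazy_chain \<Omega> P"
    and reversible: "reversible_chain \<Omega> P \<pi>"
begin

abbreviation "p \<equiv> step_prob \<Omega> P"

definition act :: "nat \<Rightarrow> ('a \<Rightarrow> real) \<Rightarrow> 'a \<Rightarrow> real" where
  "act t f x = (\<Sum>y\<in>\<Omega>. p t x y * f y)"

definition ip :: "('a \<Rightarrow> real) \<Rightarrow> ('a \<Rightarrow> real) \<Rightarrow> real" where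
  "ip f g = (\<Sum>x\<in>\<Omega>. \<pi> x * (f x * g x))"

definition mean :: "('a \<Rightarrow> real) \<Rightarrow> real" where
  "mean f = (\<Sum>x\<in>\<Omega>. \<pi> x * f x)"

text \<open>Cutting the density of P^t(x, -) at 1 keeps its \<open>ip\<close>-norm at most 1 and
  costs in the mean exactly the total variation distance to pi.\<close>

definition truncated_density :: "nat \<Rightarrow> 'a \<Rightarrow> 'a \<Rightarrow> real" where
  "truncated_density t x z = min (p t x z / \<pi> z) 1"

section \<open>Transition probabilities: semigroup property, reversibility, positivity of pi\<close>

lemma fin: "finite \<Omega>" and nonempty: "\<Omega> \<noteq> {}"
  and P_nonneg: "x \<in> \<Omega> \<Longrightarrow> y \<in> \<Omega> \<Longrightarrow> 0 \<le> P x y"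
  and P_sum: "x \<in> \<Omega> \<Longrightarrow> (\<Sum>y\<in>\<Omega>. P x y) = 1"
  and pi_nonneg: "x \<in> \<Omega> \<Longrightarrow> 0 \<le> \<pi> x"
  and pi_sum: "(\<Sum>x\<in>\<Omega>. \<pi> x) = 1"
  using chain by (auto simp: finite_markov_chain_def distribution_on_def)

lemma p_nonneg: "x \<in> \<Omega> \<Longrightarrow> y \<in> \<Omega> \<Longrightarrow> 0 \<le> p t x y"
  by (induction t arbitrary: x) (auto intro!: sum_nonneg mult_nonneg_nonneg P_nonneg)

lemma p_sum: "x \<in> \<Omega> \<Longrightarrow> (\<Sum>y\<in>\<Omega>. p t x y) = 1"
proof (induction t arbitrary: x)
  case 0
  then show ?case using fin by (simp add: sum.delta')
next
  case (Suc t)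
  have "(\<Sum>y\<in>\<Omega>. p (Suc t) x y) = (\<Sum>z\<in>\<Omega>. P x z * (\<Sum>y\<in>\<Omega>. p t z y))"
    unfolding step_prob.simps sum_distrib_left by (rule sum.swap)
  also have "\<dots> = (\<Sum>z\<in>\<Omega>. P x z)" using Suc.IH by (intro sum.cong) auto
  finally show ?case using P_sum Suc.prems by simp
qed

lemma p_add:
  assumes "x \<in> \<Omega>"
  shows "p (s + t) x y = (\<Sum>z\<in>\<Omega>. p s x z * p t z y)"
  using assms
proof (induction s arbitrary: x)
  case 0
  have "(\<Sum>z\<in>\<Omega>. p 0 x z * p t z y) = (\<Sum>z\<in>\<Omega>. if x = z then p t z y else 0)"
    by (intro sum.cong) auto
  then show ?case using fin 0 by (simp add: sum.delta)
next
  case (Suc s)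
  have "p (Suc s + t) x y = (\<Sum>w\<in>\<Omega>. P x w * (\<Sum>z\<in>\<Omega>. p s w z * p t z y))"
    using Suc.IH by (auto intro!: sum.cong)
  also have "\<dots> = (\<Sum>z\<in>\<Omega>. \<Sum>w\<in>\<Omega>. P x w * (p s w z * p t z y))"
    unfolding sum_distrib_left by (rule sum.swap)
  finally show ?case by (simp add: sum_distrib_right mult.assoc)
qed

lemma pi_p_reversible:
  assumes "x \<in> \<Omega>" "y \<in> \<Omega>"
  shows "\<pi> x * p t x y = \<pi> y * p t y x"
  using assms
proof (induction t arbitrary: x y)
  case 0
  then show ?case by simp
next
  case (Suc t)
  \<comment> \<open>The recursion of \<open>step_prob\<close> peels off the first step. Reversed, it
    becomes the last one, so it is rewritten as \<open>p 1\<close> for \<open>p_add\<close> to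
    append.\<close>
  have P1: "p 1 z x = P z x" if "z \<in> \<Omega>" "x \<in> \<Omega>" for z x
  proof -
    have "p 1 z x = (\<Sum>w\<in>\<Omega>. if w = x then P z w else 0)"
      unfolding One_nat_def step_prob.simps by (intro sum.cong) auto
    then show ?thesis using fin that by (simp add: sum.delta)
  qed
  have "\<pi> x * p (Suc t) x y = (\<Sum>z\<in>\<Omega>. (\<pi> x * P x z) * p t z y)"
    by (simp add: sum_distrib_left mult.assoc)
  also have "\<dots> = (\<Sum>z\<in>\<Omega>. P z x * (\<pi> z * p t z y))"
    using reversible Suc.prems by (intro sum.cong) (auto simp: reversible_chain_def)
  also have "\<dots> = (\<Sum>z\<in>\<Omega>. \<pi> y * (p t y z * p 1 z x))"
    using Suc P1 by (intro sum.cong) auto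
  also have "\<dots> = \<pi> y * p (t + 1) y x"
    using p_add[OF Suc.prems(2), of t 1 x] by (simp only: sum_distrib_left)
  finally show ?case by simp
qed

lemma pi_stationary:
  assumes "y \<in> \<Omega>"
  shows "(\<Sum>x\<in>\<Omega>. \<pi> x * p t x y) = \<pi> y"
proof -
  have "(\<Sum>x\<in>\<Omega>. \<pi> x * p t x y) = \<pi> y * (\<Sum>x\<in>\<Omega>. p t y x)"
    unfolding sum_distrib_left using assms by (intro sum.cong pi_p_reversible) auto
  then show ?thesis using p_sum assms by simp
qed

text \<open>Some state carries mass; irreducibility sends a positive share of it to
  \<open>y\<close>, and stationarity counts that share in \<open>\<pi> y\<close>.\<close>

lemma pi_pos:
  assumes "y \<in> \<Omega>"
  shows "0 < \<pi> y"
proof -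
  obtain x where x: "x \<in> \<Omega>" "0 < \<pi> x"
    using pi_sum pi_nonneg by (metis sum_nonpos not_less not_one_le_zero)
  obtain t where t: "0 < p t x y"
    using irreducible x assms by (auto simp: irreducible_chain_def)
  have "0 < \<pi> x * p t x y" using x t by simp
  also have "\<dots> \<le> (\<Sum>x\<in>\<Omega>. \<pi> x * p t x y)"
    using x assms by (intro member_le_sum[of x \<Omega> "\<lambda>x. \<pi> x * p t x y"]) (auto simp: fin pi_nonneg p_nonneg)
  finally show ?thesis using pi_stationary assms by simp
qed

section \<open>Convergence to stationarity in separation and total variation\<close>

lemma d_tv_le_iff: "d_tv \<Omega> P \<pi> t \<le> a \<longleftrightarrow> (\<forall>x\<in>\<Omega>. (\<Sum>y\<in>\<Omega>. \<bar>p t x y - \<pi> y\<bar>) \<le> 2 * a)"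
  unfolding d_tv_def tv_dist_def using fin nonempty by (subst Max_le_iff) auto

lemma d_sep_le_iff: "d_sep \<Omega> P \<pi> t \<le> a \<longleftrightarrow> (\<forall>x\<in>\<Omega>. \<forall>y\<in>\<Omega>. (1 - a) * \<pi> y \<le> p t x y)"
proof -
  have "d_sep \<Omega> P \<pi> t \<le> a \<longleftrightarrow> 1 - a \<le> (MIN (x, y)\<in>\<Omega> \<times> \<Omega>. p t x y / \<pi> y)"
    unfolding d_sep_def by linarith
  also have "\<dots> \<longleftrightarrow> (\<forall>(x, y)\<in>\<Omega> \<times> \<Omega>. 1 - a \<le> p t x y / \<pi> y)"
    using fin nonempty by (subst Min_ge_iff) auto
  also have "\<dots> \<longleftrightarrow> (\<forall>x\<in>\<Omega>. \<forall>y\<in>\<Omega>. (1 - a) * \<pi> y \<le> p t x y)"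
    using pi_pos by (auto simp: pos_le_divide_eq)
  finally show ?thesis .
qed

text \<open>Laziness lets the chain wait at \<open>x\<close> for the surplus steps, which rules out
  periodicity.\<close>

lemma p_pos_mono:
  assumes "x \<in> \<Omega>" "y \<in> \<Omega>" "0 < p t x y" "t \<le> u"
  shows "0 < p u x y"
  using assms(4)
proof (induction u rule: dec_induct)
  case (step n)
  have "1/2 \<le> P x x" using lazy assms by (auto simp: lazy_chain_def)
  then have "0 < P x x * p n x y" using step by (intro mult_pos_pos) auto
  also have "\<dots> \<le> p (Suc n) x y" unfolding step_prob.simps
    using assms by (intro member_le_sum[of x \<Omega> "\<lambda>z. P x z * p n z y"])
      (auto simp: fin P_nonneg p_nonneg)
  finally show ?case .
qed (use assms in auto)

text \<open>A Doeblin condition: positivity persists in time, so by finiteness one time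
  \<open>N\<close> serves all pairs of states.\<close>

lemma eventually_minorized: "\<exists>N c. 0 < c \<and> c \<le> 1 \<and> (\<forall>x\<in>\<Omega>. \<forall>y\<in>\<Omega>. c * \<pi> y \<le> p N x y)"
proof -
  obtain T where T: "\<And>x y. x \<in> \<Omega> \<Longrightarrow> y \<in> \<Omega> \<Longrightarrow> 0 < p (T x y) x y"
    using irreducible unfolding irreducible_chain_def by metis
  define N where "N = Max ((\<lambda>(x, y). T x y) ` (\<Omega> \<times> \<Omega>))"
  have "T x y \<le> N" if "x \<in> \<Omega>" "y \<in> \<Omega>" for x y
    unfolding N_def using that fin by (intro Max_ge) auto
  then have pos: "0 < p N x y" if "x \<in> \<Omega>" "y \<in> \<Omega>" for x y
    using that T p_pos_mono by blast
  \<comment> \<open>The cap at 1 keeps \<open>1 - c\<close> nonnegative, as needed for the decay of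
    its powers.\<close>
  define c where "c = min 1 (Min ((\<lambda>(x, y). p N x y / \<pi> y) ` (\<Omega> \<times> \<Omega>)))"
  have "0 < c" unfolding c_def using fin nonempty pos pi_pos by (auto simp: Min_gr_iff)
  moreover have "c * \<pi> y \<le> p N x y" if "x \<in> \<Omega>" "y \<in> \<Omega>" for x y
  proof -
    have "c \<le> p N x y / \<pi> y" unfolding c_def using that fin
      by (intro min.coboundedI2 Min_le) auto
    then show ?thesis using pi_pos that by (simp add: pos_le_divide_eq)
  qed
  ultimately show ?thesis by (intro exI[of _ N] exI[of _ c]) (auto simp: c_def)
qed

text \<open>By the Doeblin condition separation decays geometrically over blocks of \<open>N\<close>
  steps. Hence the sets behind \<open>t_sep\<close> and \<open>t_mix\<close> are nonempty and their
  infima attained.\<close>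

lemma ex_d_sep_le:
  assumes "0 < a"
  shows "\<exists>t. d_sep \<Omega> P \<pi> t \<le> a"
proof -
  obtain N c where c: "0 < c" "c \<le> 1" and minor: "\<And>x y. x \<in> \<Omega> \<Longrightarrow> y \<in> \<Omega> \<Longrightarrow> c * \<pi> y \<le> p N x y"
    using eventually_minorized by blast
  have *: "(1 - (1 - c) ^ k) * \<pi> y \<le> p (k * N) x y" if "x \<in> \<Omega>" "y \<in> \<Omega>" for k x y
    using that
  proof (induction k arbitrary: x)
    case 0
    then show ?case by simp
  next
    case (Suc k)
    let ?r = "1 - (1 - c) ^ k"
    \<comment> \<open>\<open>p N x\<close> is \<open>c\<close> times pi plus a nonnegative remainder
      of mass \<open>1 - c\<close>. The first part stays stationary; the induction hypothesis is
      averaged over the remainder.\<close>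
    have "(1 - (1 - c) ^ Suc k) * \<pi> y = c * \<pi> y + (1 - c) * (?r * \<pi> y)"
      by (simp add: algebra_simps)
    also have "\<dots> = c * \<pi> y + (\<Sum>z\<in>\<Omega>. (p N x z - c * \<pi> z) * (?r * \<pi> y))"
      using Suc.prems by (simp add: sum_distrib_right[symmetric] sum_subtractf p_sum pi_sum
          sum_distrib_left[symmetric])
    also have "\<dots> \<le> c * \<pi> y + (\<Sum>z\<in>\<Omega>. (p N x z - c * \<pi> z) * p (k * N) z y)"
      using Suc minor by (intro add_left_mono sum_mono mult_left_mono) auto
    also have "\<dots> = c * \<pi> y + (p (N + k * N) x y - c * (\<Sum>z\<in>\<Omega>. \<pi> z * p (k * N) z y))"
      using Suc.prems
      by (simp add: p_add left_diff_distrib sum_subtractf sum_distrib_left mult.assoc)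
    also have "\<dots> = p (Suc k * N) x y" using Suc.prems by (simp add: pi_stationary)
    finally show ?case .
  qed
  obtain k where k: "(1 - c) ^ k < a"
    using real_arch_pow_inv[of a "1 - c"] assms c by auto
  have "(1 - a) * \<pi> y \<le> p (k * N) x y" if "x \<in> \<Omega>" "y \<in> \<Omega>" for x y
    by (rule order_trans[OF mult_right_mono *[OF that, of k]]) (use k that pi_nonneg in auto)
  then show ?thesis using d_sep_le_iff by blast
qed

text \<open>The differences \<open>p t x y - \<pi> y\<close> sum to 0, so their absolute values sum
  to twice the negative parts, each at most \<open>a * \<pi> y\<close>.\<close>

lemma d_tv_le_if_d_sep_le:
  assumes "d_sep \<Omega> P \<pi> t \<le> a" "0 \<le> a"
  shows "d_tv \<Omega> P \<pi> t \<le> a"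
  unfolding d_tv_le_iff
proof
  fix x assume x: "x \<in> \<Omega>"
  have "\<bar>p t x y - \<pi> y\<bar> \<le> (p t x y - \<pi> y) + 2 * a * \<pi> y" if y: "y \<in> \<Omega>" for y
  proof -
    have "(1 - a) * \<pi> y \<le> p t x y" using assms x y d_sep_le_iff by auto
    moreover have "0 \<le> a * \<pi> y" using assms y pi_nonneg by auto
    ultimately show ?thesis by (simp add: algebra_simps abs_if)
  qed
  then have "(\<Sum>y\<in>\<Omega>. \<bar>p t x y - \<pi> y\<bar>) \<le> (\<Sum>y\<in>\<Omega>. (p t x y - \<pi> y) + 2 * a * \<pi> y)"
    by (intro sum_mono)
  also have "\<dots> = 2 * a"
    using x by (simp add: sum.distrib sum_subtractf p_sum pi_sum sum_distrib_left[symmetric])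
  finally show "(\<Sum>y\<in>\<Omega>. \<bar>p t x y - \<pi> y\<bar>) \<le> 2 * a" .
qed

text \<open>Each row at time \<open>n + 1\<close> is a convex combination of the rows at time
  \<open>n\<close>.\<close>

lemma d_tv_le_mono:
  assumes "d_tv \<Omega> P \<pi> t \<le> a" "t \<le> u"
  shows "d_tv \<Omega> P \<pi> u \<le> a"
  using assms(2)
proof (induction u rule: dec_induct)
  case (step n)
  show ?case unfolding d_tv_le_iff
  proof
    fix x assume x: "x \<in> \<Omega>"
    have "(\<Sum>y\<in>\<Omega>. \<bar>p (Suc n) x y - \<pi> y\<bar>) \<le> (\<Sum>y\<in>\<Omega>. \<Sum>z\<in>\<Omega>. P x z * \<bar>p n z y - \<pi> y\<bar>)"
    proof (intro sum_mono)
      fix y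
      have "\<pi> y = (\<Sum>z\<in>\<Omega>. P x z * \<pi> y)"
        using P_sum[OF x] by (simp add: sum_distrib_right[symmetric])
      then have "p (Suc n) x y - \<pi> y = (\<Sum>z\<in>\<Omega>. P x z * (p n z y - \<pi> y))"
        by (simp add: right_diff_distrib sum_subtractf)
      also have "\<bar>\<dots>\<bar> \<le> (\<Sum>z\<in>\<Omega>. \<bar>P x z * (p n z y - \<pi> y)\<bar>)" by (rule sum_abs)
      finally show "\<bar>p (Suc n) x y - \<pi> y\<bar> \<le> (\<Sum>z\<in>\<Omega>. P x z * \<bar>p n z y - \<pi> y\<bar>)"
        using P_nonneg x by (simp add: abs_mult)
    qed
    also have "\<dots> = (\<Sum>z\<in>\<Omega>. P x z * (\<Sum>y\<in>\<Omega>. \<bar>p n z y - \<pi> y\<bar>))"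
      unfolding sum_distrib_left by (rule sum.swap)
    also have "\<dots> \<le> (\<Sum>z\<in>\<Omega>. P x z * (2 * a))"
      using step P_nonneg x by (intro sum_mono mult_left_mono) (auto simp: d_tv_le_iff)
    also have "\<dots> = 2 * a" using P_sum x by (simp add: sum_distrib_right[symmetric])
    finally show "(\<Sum>y\<in>\<Omega>. \<bar>p (Suc n) x y - \<pi> y\<bar>) \<le> 2 * a" .
  qed
qed (use assms in auto)

section \<open>Mixing and separation times as attained minima\<close>

lemma d_sep_t_sep: "0 < a \<Longrightarrow> d_sep \<Omega> P \<pi> (t_sep \<Omega> P \<pi> a) \<le> a"
  using Inf_nat_def1[of "{t. d_sep \<Omega> P \<pi> t \<le> a}"] ex_d_sep_le[of a] by (auto simp: t_sep_def)

lemma d_tv_t_mix: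
  assumes "0 < a"
  shows "d_tv \<Omega> P \<pi> (t_mix \<Omega> P \<pi> a) \<le> a"
  using Inf_nat_def1[of "{t. d_tv \<Omega> P \<pi> t \<le> a}"] ex_d_sep_le[OF assms] d_tv_le_if_d_sep_le assms
  by (force simp: t_mix_def)

lemma t_sep_le: "d_sep \<Omega> P \<pi> t \<le> a \<Longrightarrow> t_sep \<Omega> P \<pi> a \<le> t"
  unfolding t_sep_def by (auto intro: cInf_lower)

lemma t_mix_le: "d_tv \<Omega> P \<pi> t \<le> a \<Longrightarrow> t_mix \<Omega> P \<pi> a \<le> t"
  unfolding t_mix_def by (auto intro: cInf_lower)

lemma t_sep_antimono: "0 < a \<Longrightarrow> a \<le> b \<Longrightarrow> t_sep \<Omega> P \<pi> b \<le> t_sep \<Omega> P \<pi> a"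
  by (rule t_sep_le) (use d_sep_t_sep[of a] in simp)

lemma t_mix_antimono: "0 < a \<Longrightarrow> a \<le> b \<Longrightarrow> t_mix \<Omega> P \<pi> b \<le> t_mix \<Omega> P \<pi> a"
  by (rule t_mix_le) (use d_tv_t_mix[of a] in simp)

lemma t_mix_le_t_sep: "0 < a \<Longrightarrow> t_mix \<Omega> P \<pi> a \<le> t_sep \<Omega> P \<pi> a"
  by (intro t_mix_le d_tv_le_if_d_sep_le d_sep_t_sep) auto

section \<open>The operators P^t and the pi-weighted inner product\<close>

lemma act_0: "x \<in> \<Omega> \<Longrightarrow> act 0 f x = f x"
proof -
  assume x: "x \<in> \<Omega>"
  have "act 0 f x = (\<Sum>y\<in>\<Omega>. if x = y then f y else 0)"
    unfolding act_def by (intro sum.cong) auto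
  then show ?thesis using fin x by (simp add: sum.delta)
qed

lemma act_add: "x \<in> \<Omega> \<Longrightarrow> act (s + t) f x = act s (act t f) x"
proof -
  assume x: "x \<in> \<Omega>"
  have "act (s + t) f x = (\<Sum>y\<in>\<Omega>. \<Sum>z\<in>\<Omega>. p s x z * p t z y * f y)"
    using x by (simp add: act_def p_add sum_distrib_right)
  also have "\<dots> = (\<Sum>z\<in>\<Omega>. \<Sum>y\<in>\<Omega>. p s x z * p t z y * f y)" by (rule sum.swap)
  finally show ?thesis by (simp add: act_def sum_distrib_left mult.assoc)
qed

lemma ip_act: "ip (act t f) g = ip f (act t g)"
proof -
  have "ip (act t f) g = (\<Sum>x\<in>\<Omega>. \<Sum>y\<in>\<Omega>. (\<pi> x * p t x y) * (f y * g x))"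
    by (simp add: ip_def act_def sum_distrib_left sum_distrib_right mult_ac)
  also have "\<dots> = (\<Sum>x\<in>\<Omega>. \<Sum>y\<in>\<Omega>. (\<pi> y * p t y x) * (f y * g x))"
    by (intro sum.cong arg_cong2[where f = "(*)"] pi_p_reversible) auto
  also have "\<dots> = (\<Sum>y\<in>\<Omega>. \<Sum>x\<in>\<Omega>. (\<pi> y * p t y x) * (f y * g x))" by (rule sum.swap)
  finally show ?thesis by (simp add: ip_def act_def sum_distrib_left mult_ac)
qed

lemma ip_cong: "(\<And>x. x \<in> \<Omega> \<Longrightarrow> f x = f' x) \<Longrightarrow> (\<And>x. x \<in> \<Omega> \<Longrightarrow> g x = g' x) \<Longrightarrow> ip f g = ip f' g'"
  unfolding ip_def by (intro sum.cong) auto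

lemma ip_self_nonneg: "0 \<le> ip f f"
  unfolding ip_def by (intro sum_nonneg mult_nonneg_nonneg[OF pi_nonneg]) auto

lemma ip_Cauchy_Schwarz: "(ip f g)\<^sup>2 \<le> ip f f * ip g g"
proof -
  have s: "sqrt (\<pi> x) * sqrt (\<pi> x) = \<pi> x" if "x \<in> \<Omega>" for x
    using pi_nonneg that by simp
  have e: "ip f g = (\<Sum>x\<in>\<Omega>. (sqrt (\<pi> x) * f x) * (sqrt (\<pi> x) * g x))" for f g
    unfolding ip_def using s by (intro sum.cong) (auto simp: mult_ac)
  show ?thesis unfolding e
    using Cauchy_Schwarz_ineq_sum[of "\<lambda>x. sqrt (\<pi> x) * f x" "\<lambda>x. sqrt (\<pi> x) * g x" \<Omega>]
    by (simp add: power2_eq_square)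
qed

text \<open>Schur's test: by reversibility the kernel \<open>p t x y - \<pi> y\<close> has both its rows and its
  \<open>\<pi>\<close>-weighted columns of absolute mass at most \<open>2 a\<close>.\<close>
lemma ip_act_contract:
  assumes d: "d_tv \<Omega> P \<pi> t \<le> a" and a: "0 \<le> a" and g: "mean g = 0"
  shows "ip (act t g) (act t g) \<le> (2 * a)\<^sup>2 * ip g g"
proof -
  let ?K = "\<lambda>x y. \<bar>p t x y - \<pi> y\<bar>"
  have row: "(\<Sum>y\<in>\<Omega>. ?K x y) \<le> 2 * a" if "x \<in> \<Omega>" for x
    using d that d_tv_le_iff by blast
  have col: "(\<Sum>x\<in>\<Omega>. \<pi> x * ?K x y) \<le> 2 * a * \<pi> y" if y: "y \<in> \<Omega>" for y
  proof -
    have "\<pi> x * ?K x y = \<pi> y * ?K y x" if x: "x \<in> \<Omega>" for x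
    proof -
      have "\<pi> x * ?K x y = \<bar>\<pi> x * p t x y - \<pi> x * \<pi> y\<bar>"
        using pi_nonneg x by (simp add: abs_mult flip: right_diff_distrib)
      also have "\<dots> = \<bar>\<pi> y * p t y x - \<pi> y * \<pi> x\<bar>"
        using pi_p_reversible x y by (simp add: mult.commute)
      also have "\<dots> = \<pi> y * ?K y x"
        using pi_nonneg y by (simp add: abs_mult flip: right_diff_distrib)
      finally show ?thesis .
    qed
    then have "(\<Sum>x\<in>\<Omega>. \<pi> x * ?K x y) = \<pi> y * (\<Sum>x\<in>\<Omega>. ?K y x)"
      by (simp add: sum_distrib_left)
    also have "\<dots> \<le> \<pi> y * (2 * a)"
      using row y pi_nonneg by (intro mult_left_mono) auto
    finally show ?thesis by (simp add: mult.commute)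
  qed
  have pt: "act t g x * act t g x \<le> 2 * a * (\<Sum>y\<in>\<Omega>. ?K x y * (g y)\<^sup>2)" if x: "x \<in> \<Omega>" for x
  proof -
    \<comment> \<open>Since \<open>g\<close> has mean zero, pi may be subtracted from every row of
      the kernel.\<close>
    have "act t g x = (\<Sum>y\<in>\<Omega>. (p t x y - \<pi> y) * g y)"
      using g by (simp add: act_def mean_def left_diff_distrib sum_subtractf)
    also have "\<bar>\<dots>\<bar> \<le> (\<Sum>y\<in>\<Omega>. \<bar>(p t x y - \<pi> y) * g y\<bar>)" by (rule sum_abs)
    \<comment> \<open>Splitting the kernel into two square roots lets Cauchy-Schwarz produce a row
      sum times a kernel-weighted sum of squares.\<close>
    also have "\<dots> = (\<Sum>y\<in>\<Omega>. sqrt (?K x y) * (sqrt (?K x y) * \<bar>g y\<bar>))"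
      by (intro sum.cong) (auto simp: abs_mult simp flip: mult.assoc)
    finally have "\<bar>act t g x\<bar> \<le> (\<Sum>y\<in>\<Omega>. sqrt (?K x y) * (sqrt (?K x y) * \<bar>g y\<bar>))" .
    then have "\<bar>act t g x\<bar>\<^sup>2 \<le> (\<Sum>y\<in>\<Omega>. sqrt (?K x y) * (sqrt (?K x y) * \<bar>g y\<bar>))\<^sup>2"
      by (intro power_mono) auto
    also have "\<dots> \<le> (\<Sum>y\<in>\<Omega>. (sqrt (?K x y))\<^sup>2) * (\<Sum>y\<in>\<Omega>. (sqrt (?K x y) * \<bar>g y\<bar>)\<^sup>2)"
      by (rule Cauchy_Schwarz_ineq_sum)
    also have "\<dots> = (\<Sum>y\<in>\<Omega>. ?K x y) * (\<Sum>y\<in>\<Omega>. ?K x y * (g y)\<^sup>2)"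
      by (simp add: power_mult_distrib)
    also have "\<dots> \<le> 2 * a * (\<Sum>y\<in>\<Omega>. ?K x y * (g y)\<^sup>2)"
      using row x by (intro mult_right_mono sum_nonneg) auto
    finally show ?thesis by (simp add: power2_eq_square)
  qed
  have "ip (act t g) (act t g) \<le> (\<Sum>x\<in>\<Omega>. \<pi> x * (2 * a * (\<Sum>y\<in>\<Omega>. ?K x y * (g y)\<^sup>2)))"
    unfolding ip_def using pt pi_nonneg by (intro sum_mono mult_left_mono) auto
  also have "\<dots> = 2 * a * (\<Sum>x\<in>\<Omega>. \<Sum>y\<in>\<Omega>. \<pi> x * ?K x y * (g y)\<^sup>2)"
    by (simp add: sum_distrib_left mult_ac)
  also have "\<dots> = 2 * a * (\<Sum>y\<in>\<Omega>. (\<Sum>x\<in>\<Omega>. \<pi> x * ?K x y) * (g y)\<^sup>2)"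
    unfolding sum_distrib_right by (subst sum.swap) simp
  also have "\<dots> \<le> 2 * a * (\<Sum>y\<in>\<Omega>. 2 * a * \<pi> y * (g y)\<^sup>2)"
    using a col by (intro mult_left_mono sum_mono mult_right_mono) auto
  also have "\<dots> = (2 * a)\<^sup>2 * ip g g"
    by (simp add: ip_def sum_distrib_left power2_eq_square mult_ac)
  finally show ?thesis .
qed

text \<open>By self-adjointness the squared norm of P^u g is the inner product of g with P^(2u) g,
  hence at most the norm of P^(2u) g when g has norm at most 1. Iterated doubling of u replaces a
  spectral decomposition.\<close>

lemma ip_act_log_convex:
  assumes "ip g g \<le> 1"
  shows "(ip (act s g) (act s g)) ^ (2 ^ j) \<le> ip (act (2 ^ j * s) g) (act (2 ^ j * s) g)"
proof (induction j)
  case (Suc j)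
  let ?u = "2 ^ j * s"
  let ?a = "ip (act ?u g) (act ?u g)"
  have "ip (act s g) (act s g) ^ (2 ^ Suc j) = (ip (act s g) (act s g) ^ (2 ^ j))\<^sup>2"
    by (simp add: mult.commute flip: power_mult)
  also have "\<dots> \<le> ?a\<^sup>2"
    using Suc ip_self_nonneg by (intro power_mono) auto
  also have "?a = ip g (act (?u + ?u) g)"
    using ip_act[of ?u g "act ?u g"] by (simp add: act_add cong: ip_cong)
  also have "(ip g (act (?u + ?u) g))\<^sup>2 \<le> ip g g * ip (act (?u + ?u) g) (act (?u + ?u) g)"
    by (rule ip_Cauchy_Schwarz)
  also have "\<dots> \<le> 1 * ip (act (?u + ?u) g) (act (?u + ?u) g)"
    using assms ip_self_nonneg by (intro mult_right_mono) auto
  finally show ?case by (simp add: mult_2 distrib_right)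
qed simp

section \<open>Truncated densities and bounds on separation times\<close>

lemma truncated_density_bounds:
  assumes "x \<in> \<Omega>" "z \<in> \<Omega>"
  shows "0 \<le> truncated_density t x z" "truncated_density t x z \<le> 1"
  using assms p_nonneg pi_nonneg by (auto simp: truncated_density_def)

lemma pi_truncated_density:
  assumes "z \<in> \<Omega>"
  shows "\<pi> z * truncated_density t x z = min (p t x z) (\<pi> z)"
  using pi_pos[OF assms] by (auto simp: truncated_density_def min_def field_simps)

text \<open>A minimum is half of the sum minus the distance, so this mean is one minus the total
  variation distance from \<open>x\<close>.\<close>

lemma mean_truncated_density:
  assumes "d_tv \<Omega> P \<pi> t \<le> a" "x \<in> \<Omega>"
  shows "1 - a \<le> mean (truncated_density t x)"
proof -
  have "mean (truncated_density t x) = (\<Sum>z\<in>\<Omega>. (p t x z + \<pi> z - \<bar>p t x z - \<pi> z\<bar>) / 2)"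
    unfolding mean_def by (intro sum.cong) (auto simp: pi_truncated_density)
  also have "\<dots> = (2 - (\<Sum>z\<in>\<Omega>. \<bar>p t x z - \<pi> z\<bar>)) / 2"
    using assms by (simp add: sum_divide_distrib[symmetric] sum_subtractf sum.distrib p_sum pi_sum)
  moreover have "(\<Sum>z\<in>\<Omega>. \<bar>p t x z - \<pi> z\<bar>) \<le> 2 * a"
    using assms d_tv_le_iff by blast
  ultimately show ?thesis by simp
qed

text \<open>Paths are split at their positions \<open>z\<close> after \<open>t\<close> and
  \<open>w\<close> after \<open>t + s\<close> steps. Reversibility turns the density of the walk
  started at \<open>y\<close> into the last \<open>t\<close> steps towards \<open>y\<close>.\<close>

lemma p_ge_ip_truncated_density:
  assumes x: "x \<in> \<Omega>" and y: "y \<in> \<Omega>"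
  shows "ip (truncated_density t x) (act s (truncated_density t y)) * \<pi> y \<le> p (t + (s + t)) x y"
proof -
  let ?f = "truncated_density t"
  have "(\<pi> z * ?f x z) * (p s z w * ?f y w) * \<pi> y \<le> p t x z * (p s z w * p t w y)"
    if "z \<in> \<Omega>" "w \<in> \<Omega>" for z w
  proof -
    have 1: "\<pi> z * ?f x z \<le> p t x z" using that by (simp add: pi_truncated_density)
    have "?f y w * \<pi> y \<le> p t y w / \<pi> w * \<pi> y"
      using pi_nonneg y by (intro mult_right_mono) (auto simp: truncated_density_def)
    also have "\<dots> = p t w y"
      using pi_p_reversible[of w y t] that y pi_pos[of w] by (simp add: field_simps)
    finally have 2: "?f y w * \<pi> y \<le> p t w y" .
    have "(\<pi> z * ?f x z) * (p s z w * (?f y w * \<pi> y)) \<le> p t x z * (p s z w * p t w y)"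
      using 1 2 that x y p_nonneg pi_nonneg truncated_density_bounds
      by (intro mult_mono mult_left_mono mult_nonneg_nonneg) auto
    then show ?thesis by (simp add: mult_ac)
  qed
  then have "(\<Sum>z\<in>\<Omega>. \<Sum>w\<in>\<Omega>. (\<pi> z * ?f x z) * (p s z w * ?f y w) * \<pi> y)
      \<le> (\<Sum>z\<in>\<Omega>. \<Sum>w\<in>\<Omega>. p t x z * (p s z w * p t w y))"
    by (intro sum_mono)
  also have "\<dots> = p (t + (s + t)) x y"
    using x by (simp add: p_add sum_distrib_left)
  finally show ?thesis
    by (simp add: ip_def act_def sum_distrib_left sum_distrib_right mult_ac)
qed

text \<open>Functions with values in [0, 1] and means at least 3/4 overlap by at least 1/2 without
  decorrelation, so \<open>s = 0\<close> suffices. This ties separation to \<open>t_mix\<close> at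
  1/4, the common time scale below.\<close>

lemma t_sep_half_le: "t_sep \<Omega> P \<pi> (1/2) \<le> 2 * t_mix \<Omega> P \<pi> (1/4)"
proof -
  let ?t = "t_mix \<Omega> P \<pi> (1/4)"
  let ?f = "truncated_density ?t"
  have d: "d_tv \<Omega> P \<pi> ?t \<le> 1/4" by (rule d_tv_t_mix) simp
  have "(1 - 1/2) * \<pi> y \<le> p (?t + (0 + ?t)) x y" if xy: "x \<in> \<Omega>" "y \<in> \<Omega>" for x y
  proof -
    have "1/2 \<le> mean (?f x) + mean (?f y) - 1"
      using mean_truncated_density[OF d xy(1)] mean_truncated_density[OF d xy(2)] by linarith
    also have "\<dots> = (\<Sum>z\<in>\<Omega>. \<pi> z * (?f x z + ?f y z - 1))"
      by (simp add: mean_def pi_sum distrib_left right_diff_distrib sum.distrib sum_subtractf)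
    also have "\<dots> \<le> ip (?f x) (?f y)"
      unfolding ip_def
    proof (intro sum_mono mult_left_mono)
      fix z assume z: "z \<in> \<Omega>"
      have "0 \<le> (1 - ?f x z) * (1 - ?f y z)"
        using truncated_density_bounds xy z by (intro mult_nonneg_nonneg) auto
      then show "?f x z + ?f y z - 1 \<le> ?f x z * ?f y z" by (simp add: algebra_simps)
    qed (use pi_nonneg in auto)
    also have "\<dots> = ip (?f x) (act 0 (?f y))" by (simp add: act_0 cong: ip_cong)
    finally have "(1 - 1/2) * \<pi> y \<le> ip (?f x) (act 0 (?f y)) * \<pi> y"
      using pi_nonneg xy by (intro mult_right_mono) auto
    also have "\<dots> \<le> p (?t + (0 + ?t)) x y" by (rule p_ge_ip_truncated_density[OF xy])
    finally show ?thesis .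
  qed
  then have "d_sep \<Omega> P \<pi> (?t + (0 + ?t)) \<le> 1/2" using d_sep_le_iff by blast
  then show ?thesis using t_sep_le by fastforce
qed

text \<open>\<open>P\<^sup>s\<close> decorrelates the truncated densities up to \<open>e\<^sup>2 / 2\<close>: by log-convexity its norm on
  centred functions is at most the \<open>2 ^ j\<close>-th root of that of \<open>P\<close> to the power \<open>2 ^ j * s\<close>.\<close>
lemma t_sep_le_t_mix_add:
  assumes e: "0 < e" "e < 1"
    and s: "t_mix \<Omega> P \<pi> ((e\<^sup>2 / 2) ^ (2 ^ j) / 2) \<le> 2 ^ j * s"
  shows "t_sep \<Omega> P \<pi> (1 - e\<^sup>2 / 2) \<le> 2 * t_mix \<Omega> P \<pi> (1 - e) + s"
proof -
  let ?t = "t_mix \<Omega> P \<pi> (1 - e)"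
  let ?f = "truncated_density ?t"
  define \<theta> where "\<theta> = e\<^sup>2 / 2"
  have \<theta>: "0 < \<theta>" using e by (simp add: \<theta>_def)
  have d: "d_tv \<Omega> P \<pi> ?t \<le> 1 - e" by (rule d_tv_t_mix) (use e in simp)
  have d': "d_tv \<Omega> P \<pi> (2 ^ j * s) \<le> \<theta> ^ (2 ^ j) / 2"
    by (rule d_tv_le_mono[OF d_tv_t_mix s[folded \<theta>_def]]) (use \<theta> in simp)
  have "(1 - (1 - \<theta>)) * \<pi> y \<le> p (?t + (s + ?t)) x y" if xy: "x \<in> \<Omega>" "y \<in> \<Omega>" for x y
  proof -
    define m where "m = mean (?f y)"
    define g where "g = (\<lambda>z. ?f y z - m)"
    have mx: "e \<le> mean (?f x)" and my: "e \<le> m"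
      using mean_truncated_density[OF d xy(1)] mean_truncated_density[OF d xy(2)]
      by (simp_all add: m_def)
    have g0: "mean g = 0"
      by (simp add: g_def m_def mean_def right_diff_distrib sum_subtractf pi_sum
          sum_distrib_right[symmetric])
    have norm_f: "ip (?f z) (?f z) \<le> 1" if z: "z \<in> \<Omega>" for z
    proof -
      have "ip (?f z) (?f z) \<le> (\<Sum>w\<in>\<Omega>. \<pi> w * (1 * 1))"
        unfolding ip_def using z truncated_density_bounds pi_nonneg
        by (intro sum_mono mult_left_mono mult_mono) auto
      then show ?thesis using pi_sum by simp
    qed
    have "ip g g = ip (?f y) (?f y) - 2 * m * mean (?f y) + m * m * (\<Sum>x\<in>\<Omega>. \<pi> x)"
      unfolding ip_def g_def mean_def sum_distrib_left
      by (simp add: algebra_simps flip: sum_subtractf sum.distrib)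
    also have "\<dots> = ip (?f y) (?f y) - m * m" by (simp add: pi_sum m_def)
    finally have g1: "ip g g \<le> 1" using norm_f[OF xy(2)] zero_le_square[of m] by linarith
    let ?b = "ip (act s g) (act s g)"
    have "?b ^ (2 ^ j) \<le> ip (act (2 ^ j * s) g) (act (2 ^ j * s) g)"
      by (rule ip_act_log_convex[OF g1])
    also have "\<dots> \<le> (2 * (\<theta> ^ (2 ^ j) / 2))\<^sup>2 * ip g g"
      by (rule ip_act_contract[OF d' _ g0]) (use \<theta> in simp)
    also have "\<dots> \<le> (2 * (\<theta> ^ (2 ^ j) / 2))\<^sup>2 * 1"
      using g1 by (intro mult_left_mono) auto
    \<comment> \<open>The 1/2 in the assumption on \<open>s\<close> cancels the 2 from
      \<open>ip_act_contract\<close>, so the \<open>2 ^ j\<close>-th root is exactly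
      \<open>\<theta>\<^sup>2\<close>.\<close>
    also have "\<dots> = (\<theta>\<^sup>2) ^ (2 ^ j)" by (simp add: mult.commute flip: power_mult)
    finally have b: "?b \<le> \<theta>\<^sup>2"
      using power_mono_iff[of ?b "\<theta>\<^sup>2" "2 ^ j"] ip_self_nonneg by simp
    have "(ip (?f x) (act s g))\<^sup>2 \<le> ip (?f x) (?f x) * ?b" by (rule ip_Cauchy_Schwarz)
    also have "\<dots> \<le> 1 * \<theta>\<^sup>2"
      using norm_f xy b ip_self_nonneg by (intro mult_mono) auto
    finally have "\<bar>ip (?f x) (act s g)\<bar> \<le> \<theta>"
      using \<theta> abs_le_square_iff[of "ip (?f x) (act s g)" \<theta>] by simp
    then have corr: "- \<theta> \<le> ip (?f x) (act s g)" by linarith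
    have split: "act s (?f y) z = m + act s g z" if "z \<in> \<Omega>" for z
      using that by (simp add: act_def g_def right_diff_distrib sum_subtractf p_sum
          sum_distrib_right[symmetric])
    have "ip (?f x) (act s (?f y)) = ip (?f x) (\<lambda>z. m + act s g z)"
      by (rule ip_cong) (use split in auto)
    also have "\<dots> = mean (?f x) * m + ip (?f x) (act s g)"
      by (simp add: ip_def mean_def algebra_simps sum.distrib sum_distrib_left)
    \<comment> \<open>The means contribute at least \<open>e * e = 2 * \<theta>\<close>, and the
      correlation takes away at most \<open>\<theta>\<close>.\<close>
    also have "\<dots> \<ge> e * e - \<theta>"
      using mult_mono[OF mx my] mx e corr by simp
    finally have "\<theta> \<le> ip (?f x) (act s (?f y))"
      by (simp add: \<theta>_def power2_eq_square)
    then have "(1 - (1 - \<theta>)) * \<pi> y \<le> ip (?f x) (act s (?f y)) * \<pi> y"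
      using pi_nonneg xy by (intro mult_right_mono) auto
    also have "\<dots> \<le> p (?t + (s + ?t)) x y" by (rule p_ge_ip_truncated_density[OF xy])
    finally show ?thesis .
  qed
  then have "d_sep \<Omega> P \<pi> (?t + (s + ?t)) \<le> 1 - \<theta>" using d_sep_le_iff by blast
  then show ?thesis using t_sep_le unfolding \<theta>_def by fastforce
qed

end

section \<open>Sequences of chains: from ratios to inequalities and back\<close>

lemma ereal_divide_le_iff_real:
  fixes a b c :: real
  assumes "0 \<le> a" "0 \<le> b" "0 \<le> c"
  shows "ereal a / ereal b \<le> ereal c \<longleftrightarrow> a \<le> c * b"
proof (cases "b = 0")
  \<comment> \<open>With the conventions \<open>a / 0 = \<infinity>\<close> for positive
    \<open>a\<close> and \<open>0 / 0 = 0\<close>, both sides say \<open>a = 0\<close>.\<close>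
  case True
  then show ?thesis using assms by (cases "a = 0") (auto simp: divide_ereal_def)
next
  case False
  then show ?thesis using assms by (simp add: pos_divide_le_eq)
qed

theorem mainTheorem4:
  fixes \<Omega> :: "nat \<Rightarrow> 'a set"
    and P :: "nat \<Rightarrow> 'a \<Rightarrow> 'a \<Rightarrow> real"
    and \<pi> :: "nat \<Rightarrow> 'a \<Rightarrow> real"
  assumes chain: "\<And>n. finite_markov_chain (\<Omega> n) (P n) (\<pi> n)"
    and irreducible: "\<And>n. irreducible_chain (\<Omega> n) (P n)"
    and lazy: "\<And>n. lazy_chain (\<Omega> n) (P n)"
    and reversible: "\<And>n. reversible_chain (\<Omega> n) (P n) (\<pi> n)"
    and t_mix_diverges: "filterlim (\<lambda>n. t_mix (\<Omega> n) (P n) (\<pi> n) (1 / 4)) at_top sequentially"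
  shows "(SUP \<epsilon>\<in>{0<..1/2}. limsup (\<lambda>n. mix_ratio (\<Omega> n) (P n) (\<pi> n) \<epsilon>))
       \<le> 2 * (SUP \<epsilon>\<in>{0<..1/2}. limsup (\<lambda>n. sep_ratio (\<Omega> n) (P n) (\<pi> n) \<epsilon>))"
proof -
  define M where "M n a = real (t_mix (\<Omega> n) (P n) (\<pi> n) a)" for n a
  define S where "S n a = real (t_sep (\<Omega> n) (P n) (\<pi> n) a)" for n a
  define R where "R = (SUP \<epsilon>\<in>{0<..1/2}. limsup (\<lambda>n. sep_ratio (\<Omega> n) (P n) (\<pi> n) \<epsilon>))"
  interpret C: reversible_markov_chain "\<Omega> n" "P n" "\<pi> n" for n
    using chain irreducible lazy reversible by unfold_locales
  have M_mono: "M n b \<le> M n a" if "0 < a" "a \<le> b" for n a b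
    unfolding M_def using C.t_mix_antimono[OF that] by simp
  have S_mono: "S n b \<le> S n a" if "0 < a" "a \<le> b" for n a b
    unfolding S_def using C.t_sep_antimono[OF that] by simp
  have M_le_S: "M n a \<le> S n a" if "0 < a" for n a
    unfolding M_def S_def using C.t_mix_le_t_sep[OF that] by simp
  have S_half: "S n (1/2) \<le> 2 * M n (1/4)" for n
    using C.t_sep_half_le[of n] unfolding M_def S_def by linarith
  have nn: "0 \<le> M n a" "0 \<le> S n a" for n a by (auto simp: M_def S_def)
  have M_top: "filterlim (\<lambda>n. M n (1/4)) at_top sequentially"
    unfolding M_def using filterlim_compose[OF filterlim_real_sequentially t_mix_diverges] .
  have R_upper: "limsup (\<lambda>n. sep_ratio (\<Omega> n) (P n) (\<pi> n) \<epsilon>) \<le> R" if "0 < \<epsilon>" "\<epsilon> \<le> 1/2" for \<epsilon>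
    unfolding R_def using that by (intro SUP_upper) auto
  \<comment> \<open>Nonnegativity excludes a supremum of minus infinity, so a finite
    \<open>R\<close> is a real \<open>r \<ge> 0\<close>.\<close>
  have "0 \<le> limsup (\<lambda>n. sep_ratio (\<Omega> n) (P n) (\<pi> n) (1/2))"
    by (rule le_Limsup) (auto simp: sep_ratio_def intro!: always_eventually)
  then have R0: "0 \<le> R" using R_upper[of "1/2"] by simp
  show ?thesis
  proof (cases "R = \<infinity>")
    case True
    then show ?thesis by (simp flip: R_def)
  next
    case False
    then obtain r where r: "R = ereal r" "0 \<le> r" using R0 by (cases R) auto
    have sep: "\<forall>\<^sub>F n in sequentially. S n \<epsilon> \<le> (r + \<eta>) * S n (1 - \<epsilon>)"
      if "0 < \<epsilon>" "\<epsilon> \<le> 1/2" "0 < \<eta>" for \<epsilon> \<eta>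
    proof -
      have "limsup (\<lambda>n. sep_ratio (\<Omega> n) (P n) (\<pi> n) \<epsilon>) < ereal (r + \<eta>)"
        by (rule le_less_trans[OF R_upper]) (use that r in simp_all)
      then have "\<forall>\<^sub>F n in sequentially. sep_ratio (\<Omega> n) (P n) (\<pi> n) \<epsilon> < ereal (r + \<eta>)"
        by (rule Limsup_lessD)
      then show ?thesis
      proof eventually_elim
        case (elim n)
        then have "ereal (S n \<epsilon>) / ereal (S n (1 - \<epsilon>)) \<le> ereal (r + \<eta>)"
          unfolding sep_ratio_def S_def by (rule less_imp_le)
        moreover have "0 \<le> r + \<eta>" using r that by simp
        ultimately show ?case using ereal_divide_le_iff_real nn by blast
      qed
    qed
    have short: "\<forall>\<^sub>F n in sequentially. S n (1 - \<epsilon>\<^sup>2 / 2) \<le> 2 * M n (1 - \<epsilon>) + \<eta> * M n (1/4)"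
      if \<epsilon>: "0 < \<epsilon>" "\<epsilon> \<le> 1/4" and \<eta>: "0 < \<eta>" for \<epsilon> \<eta>
    proof -
      \<comment> \<open>Below, \<open>M n \<delta> \<le> 2 * (r + 1) * M n (1/4)\<close> with a
        factor free of \<open>\<delta>\<close>. So \<open>j\<close> can be fixed first, making
        \<open>M n \<delta> / 2 ^ j\<close> at most half of the allowed error, although
        \<open>\<delta>\<close> depends on \<open>j\<close>.\<close>
      obtain j :: nat where j: "4 * (r + 1) / \<eta> < 2 ^ j"
        using real_arch_pow[of 2 "4 * (r + 1) / \<eta>"] by auto
      define \<delta> where "\<delta> = (\<epsilon>\<^sup>2 / 2) ^ (2 ^ j) / 2"
      have "(\<epsilon>\<^sup>2 / 2) ^ (2 ^ j) \<le> 1"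
        using \<epsilon> power_mono[of \<epsilon> 1 2] by (intro power_le_one) auto
      then have \<delta>: "0 < \<delta>" "\<delta> \<le> 1/2" using \<epsilon> by (auto simp: \<delta>_def)
      \<comment> \<open>The other half of the error absorbs the 1 lost by rounding \<open>s\<close>
        up.\<close>
      have "\<forall>\<^sub>F n in sequentially. 2 / \<eta> \<le> M n (1/4)"
        using M_top by (simp add: filterlim_at_top)
      with sep[OF \<delta> zero_less_one] show ?thesis
      proof eventually_elim
        case (elim n)
        define s where "s = nat \<lceil>M n \<delta> / 2 ^ j\<rceil>"
        have "M n \<delta> / 2 ^ j \<le> real s" unfolding s_def by linarith
        then have "M n \<delta> \<le> real (2 ^ j * s)" by (simp add: field_simps)
        then have s: "t_mix (\<Omega> n) (P n) (\<pi> n) \<delta> \<le> 2 ^ j * s" unfolding M_def by linarith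
        have "M n \<delta> \<le> S n \<delta>" using M_le_S \<delta> by simp
        also have "\<dots> \<le> (r + 1) * S n (1 - \<delta>)" by (rule elim(1))
        also have "\<dots> \<le> (r + 1) * (2 * M n (1/4))"
          using S_mono[of "1/2" "1 - \<delta>" n] S_half[of n] \<delta> r by (intro mult_left_mono) auto
        also have "\<dots> = (4 * (r + 1)) * M n (1/4) / 2" by simp
        also have "\<dots> \<le> (\<eta> * 2 ^ j) * M n (1/4) / 2"
          using j \<eta> nn by (intro divide_right_mono mult_right_mono) (auto simp: field_simps)
        finally have "M n \<delta> / 2 ^ j \<le> \<eta> * M n (1/4) / 2" by (simp add: field_simps)
        moreover have "1 \<le> \<eta> * M n (1/4) / 2" using elim(2) \<eta> by (simp add: field_simps)
        moreover have "0 \<le> M n \<delta> / 2 ^ j" using nn by simp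
        then have "real s \<le> M n \<delta> / 2 ^ j + 1" unfolding s_def by linarith
        moreover have "S n (1 - \<epsilon>\<^sup>2 / 2) \<le> 2 * M n (1 - \<epsilon>) + real s"
          using C.t_sep_le_t_mix_add[of \<epsilon> n j s] \<epsilon> s unfolding \<delta>_def M_def S_def by linarith
        ultimately show ?case by linarith
      qed
    qed
    have small: "limsup (\<lambda>n. mix_ratio (\<Omega> n) (P n) (\<pi> n) \<epsilon>) \<le> ereal (2 * r)"
      if \<epsilon>: "0 < \<epsilon>" "\<epsilon> \<le> 1/4" for \<epsilon>
    proof (rule ereal_le_epsilon2)
      fix c :: real assume c: "0 < c"
      \<comment> \<open>\<open>bal\<close> below amounts to
        \<open>\<eta> * (2 + (2 * r + c) * (r + \<eta>)) \<le> c\<close>; since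
        \<open>\<eta> \<le> 1\<close>, the bracket is at most \<open>D\<close>.\<close>
      define D where "D = 2 + (2 * r + c) * (r + 1)"
      define \<eta> where "\<eta> = min 1 (c / D)"
      have D: "0 < D" using r c by (simp add: D_def add_pos_nonneg)
      have \<eta>: "0 < \<eta>" "\<eta> \<le> 1" "\<eta> \<le> c / D" using c D by (auto simp: \<eta>_def)
      have "\<eta> * (2 + (2 * r + c) * (r + 1)) \<le> c"
        using \<eta>(3) D unfolding D_def[symmetric] by (simp add: pos_le_divide_eq)
      moreover have "(2 * r + c) * (r + \<eta>) \<le> (2 * r + c) * (r + 1)"
        using r c \<eta> by (intro mult_left_mono) auto
      then have "\<eta> * ((2 * r + c) * (r + \<eta>)) \<le> \<eta> * ((2 * r + c) * (r + 1))"
        by (rule mult_left_mono[OF _ less_imp_le[OF \<eta>(1)]])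
      ultimately have bal: "2 * (r + \<eta>) \<le> (2 * r + c) * (1 - (r + \<eta>) * \<eta>)"
        by (simp add: algebra_simps)
      define \<theta> where "\<theta> = \<epsilon>\<^sup>2 / 2"
      have "\<epsilon>\<^sup>2 \<le> 1 * \<epsilon>"
        unfolding power2_eq_square using \<epsilon> by (intro mult_right_mono) auto
      moreover have "0 < \<epsilon>\<^sup>2" using \<epsilon> by simp
      ultimately have \<theta>: "0 < \<theta>" "\<theta> \<le> \<epsilon>" "\<theta> \<le> 1/2"
        unfolding \<theta>_def using \<epsilon> by linarith+
      have "\<forall>\<^sub>F n in sequentially. mix_ratio (\<Omega> n) (P n) (\<pi> n) \<epsilon> \<le> ereal (2 * r + c)"
        using sep[OF \<theta>(1,3) \<eta>(1)] short[OF \<epsilon> \<eta>(1), folded \<theta>_def]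
      proof eventually_elim
        case (elim n)
        have "M n \<epsilon> \<le> S n \<theta>" using M_mono[of \<theta> \<epsilon> n] M_le_S[of \<theta> n] \<theta> by simp
        also have "\<dots> \<le> (r + \<eta>) * S n (1 - \<theta>)" by (rule elim(1))
        also have "\<dots> \<le> (r + \<eta>) * (2 * M n (1 - \<epsilon>) + \<eta> * M n (1/4))"
          using elim(2) r \<eta> by (intro mult_left_mono) auto
        \<comment> \<open>As \<open>\<epsilon> \<le> 1/4\<close>, the error is a small multiple of
          \<open>M n \<epsilon>\<close> and can be moved to the left-hand side.\<close>
        also have "\<dots> \<le> (r + \<eta>) * (2 * M n (1 - \<epsilon>) + \<eta> * M n \<epsilon>)"
          using M_mono[of \<epsilon> "1/4" n] \<epsilon> r \<eta> by (intro mult_left_mono add_left_mono) auto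
        finally have "M n \<epsilon> * (1 - (r + \<eta>) * \<eta>) \<le> 2 * (r + \<eta>) * M n (1 - \<epsilon>)"
          by (simp add: algebra_simps)
        also have "\<dots> \<le> (2 * r + c) * (1 - (r + \<eta>) * \<eta>) * M n (1 - \<epsilon>)"
          using bal nn by (intro mult_right_mono) auto
        finally have "M n \<epsilon> * (1 - (r + \<eta>) * \<eta>) \<le> ((2 * r + c) * M n (1 - \<epsilon>)) * (1 - (r + \<eta>) * \<eta>)"
          by (simp add: mult_ac)
        \<comment> \<open>The left side of \<open>bal\<close> is positive, so the factor to be
          cancelled is too.\<close>
        moreover have "0 < (2 * r + c) * (1 - (r + \<eta>) * \<eta>)"
          by (rule less_le_trans[OF _ bal]) (use r \<eta> in simp)
        then have "0 < 1 - (r + \<eta>) * \<eta>"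
          by (rule zero_less_mult_pos) (use r c in simp)
        ultimately have "M n \<epsilon> \<le> (2 * r + c) * M n (1 - \<epsilon>)"
          by (rule mult_right_le_imp_le)
        moreover have "0 \<le> 2 * r + c" using r c by simp
        ultimately have "ereal (M n \<epsilon>) / ereal (M n (1 - \<epsilon>)) \<le> ereal (2 * r + c)"
          using ereal_divide_le_iff_real nn by blast
        then show ?case unfolding mix_ratio_def M_def .
      qed
      then show "limsup (\<lambda>n. mix_ratio (\<Omega> n) (P n) (\<pi> n) \<epsilon>) \<le> ereal (2 * r) + ereal c"
        by (simp add: Limsup_bounded)
    qed
    \<comment> \<open>Increasing \<open>\<epsilon>\<close> lowers the numerator and raises the
      denominator. Positivity of \<open>M n (1/4)\<close> excludes \<open>0 / 0\<close> at 1/4, so a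
      vanishing denominator there gives an infinite bound.\<close>
    have large: "limsup (\<lambda>n. mix_ratio (\<Omega> n) (P n) (\<pi> n) \<epsilon>)
        \<le> limsup (\<lambda>n. mix_ratio (\<Omega> n) (P n) (\<pi> n) (1/4))" if \<epsilon>: "1/4 \<le> \<epsilon>" "\<epsilon> \<le> 1/2" for \<epsilon>
    proof (rule Limsup_mono)
      have "\<forall>\<^sub>F n in sequentially. 0 < M n (1/4)"
        using M_top by (simp add: filterlim_at_top_dense)
      then show "\<forall>\<^sub>F n in sequentially. mix_ratio (\<Omega> n) (P n) (\<pi> n) \<epsilon> \<le> mix_ratio (\<Omega> n) (P n) (\<pi> n) (1/4)"
      proof eventually_elim
        case (elim n)
        have 1: "M n \<epsilon> \<le> M n (1/4)" "M n (1 - 1/4) \<le> M n (1 - \<epsilon>)"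
          using M_mono[of "1/4" \<epsilon> n] M_mono[of "1 - \<epsilon>" "1 - 1/4" n] \<epsilon> by auto
        have "ereal (M n \<epsilon>) / ereal (M n (1 - \<epsilon>)) \<le> ereal (M n (1/4)) / ereal (M n (1 - 1/4))"
        proof (cases "M n (1 - 1/4) = 0")
          case True
          then show ?thesis using elim by (simp add: divide_ereal_def)
        next
          case False
          then have "0 < M n (1 - 1/4)" using nn[of n "1 - 1/4"] by linarith
          then show ?thesis using 1 nn[of n \<epsilon>] elim by (auto intro!: frac_le)
        qed
        then show ?case unfolding mix_ratio_def M_def .
      qed
    qed
    have "limsup (\<lambda>n. mix_ratio (\<Omega> n) (P n) (\<pi> n) \<epsilon>) \<le> ereal (2 * r)" if "0 < \<epsilon>" "\<epsilon> \<le> 1/2" for \<epsilon>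
      using small[of \<epsilon>] small[of "1/4"] large[of \<epsilon>] that by (cases "\<epsilon> \<le> 1/4") (auto intro: order_trans)
    then have "(SUP \<epsilon>\<in>{0<..1/2}. limsup (\<lambda>n. mix_ratio (\<Omega> n) (P n) (\<pi> n) \<epsilon>)) \<le> ereal (2 * r)"
      by (intro SUP_least) auto
    also have "\<dots> = 2 * R" using r(1) times_ereal.simps(1)[of 2 r] by simp
    finally show ?thesis unfolding R_def .
  qed
qed

end
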